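(* Let $1\le p<\infty$. Let $\sigma:\mathbb{Z}^n\times\mathbb{T}^n\to\mathbb{C}$ be a measurable function. Assume that there is a constant $C>0$ and a function $\omega\in\ell^1(\mathbb{Z}^n)$ such that $$|(\mathcal{F}_{\mathbb{T}^n}\sigma)(k,m)|\le C|\omega(m)|\quad\text{for all }k,m\in\mathbb{Z}^n.$$ Then $\mathrm{Op}(\sigma):\ell^p(\mathbb{Z}^n)\to\ell^p(\mathbb{Z}^n)$ is a bounded linear operator and $$\|\mathrm{Op}(\sigma)\|_{\mathscr{L}(\ell^p(\mathbb{Z}^n))}\le C\|\omega\|_{\ell^1(\mathbb{Z}^n)}.$$
   Context: $\mathbb{T}^n=\mathbb{R}^n/\mathbb{Z}^n$ with normalised Lebesgue measure. For $f\in\ell^1(\mathbb{Z}^n)$, $\widehat f(x)=\sum_{k\in\mathbb{Z}^n}e^{-2\pi i k\cdot x}f(k)$ and $\mathrm{Op}(\sigma)f(k)=\int_{\mathbb{T}^n}e^{2\pi i k\cdot x}\sigma(k,x)\widehat f(x)\,dx$; on $\ell^p(\mathbb{Z}^n)$ the operator is understood as the extension by density from $\ell^1(\mathbb{Z}^n)$. The Fourier transform of $\sigma$ in the second variable is $(\mathcal{F}_{\mathbb{T}^n}\sigma)(k,m)=\int_{\mathbb{T}^n}e^{-2\pi i m\cdot x}\sigma(k,x)\,dx$ (with $\sigma(k,\cdot)$ integrable for each $k$). *)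

theory Defs
  imports "HOL-Analysis.Analysis"
begin

definition ell :: "real \<Rightarrow> ('a \<Rightarrow> complex) set" where
  "ell p = {f. (\<lambda>k. norm (f k) powr p) summable_on UNIV}"

definition ell_norm :: "real \<Rightarrow> ('a \<Rightarrow> complex) \<Rightarrow> real" where
  "ell_norm p f = (\<Sum>\<^sub>\<infinity>k. norm (f k) powr p) powr (1 / p)"

definition bounded_linear_ell ::
    "real \<Rightarrow> (('a \<Rightarrow> complex) \<Rightarrow> ('a \<Rightarrow> complex)) \<Rightarrow> bool" where
  "bounded_linear_ell p T \<longleftrightarrow>
     (\<forall>f\<in>ell p. T f \<in> ell p) \<and>
     (\<forall>f\<in>ell p. \<forall>g\<in>ell p. T (\<lambda>k. f k + g k) = (\<lambda>k. T f k + T g k)) \<and>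
     (\<forall>f\<in>ell p. \<forall>c. T (\<lambda>k. c * f k) = (\<lambda>k. c * T f k)) \<and>
     (\<exists>B. \<forall>f\<in>ell p. ell_norm p (T f) \<le> B * ell_norm p f)"

text \<open>Modelled on \<^const>\<open>onorm\<close>: the zero sequence contributes \<open>0 / 0 = 0\<close>. The
  supremum is only meaningful together with \<open>bounded_linear_ell p T\<close>.\<close>

definition onorm_ell ::
    "real \<Rightarrow> (('a \<Rightarrow> complex) \<Rightarrow> ('a \<Rightarrow> complex)) \<Rightarrow> real" where
  "onorm_ell p T = (SUP f\<in>ell p. ell_norm p (T f) / ell_norm p f)"

text \<open>Extension by density of an operator \<open>A\<close> given on \<open>ell 1\<close>: the value at \<open>f \<in> ell p\<close>
  is the common \<open>ell p\<close>-limit of \<open>A (F j)\<close> along all sequences \<open>F j\<close> of \<open>ell 1\<close> that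
  converge to \<open>f\<close> in \<open>ell p\<close>. The membership \<open>A (F j) \<in> ell p\<close> is required explicitly
  because \<^const>\<open>ell_norm\<close> takes the junk value 0 outside \<open>ell p\<close>.\<close>

definition density_extension ::
    "real \<Rightarrow> (('a \<Rightarrow> complex) \<Rightarrow> ('a \<Rightarrow> complex)) \<Rightarrow> ('a \<Rightarrow> complex) \<Rightarrow> 'a \<Rightarrow> complex" where
  "density_extension p A f =
     (THE g. g \<in> ell p \<and>
        (\<forall>F. (\<forall>j::nat. F j \<in> ell 1) \<and>
             (\<lambda>j. ell_norm p (\<lambda>k. F j k - f k)) \<longlonglongrightarrow> 0 \<longrightarrow>
             (\<forall>j. A (F j) \<in> ell p) \<and>
             (\<lambda>j. ell_norm p (\<lambda>k. A (F j) k - g k)) \<longlonglongrightarrow> 0))"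

text \<open>Functions on the torus \<open>R^n / Z^n\<close> are represented by their \<open>Z^n\<close>-periodic lifts to
  \<open>R^n\<close>; integration over the torus is integration over the fundamental domain
  \<open>[0,1)^n\<close>, which has Lebesgue measure 1.\<close>

definition torus_periodic :: "(real ^ 'n \<Rightarrow> complex) \<Rightarrow> bool" where
  "torus_periodic g \<longleftrightarrow>
     (\<forall>x. \<forall>m :: int ^ 'n. g (x + (\<chi> i. real_of_int (m $ i))) = g x)"

definition torus :: "(real ^ 'n) measure" where
  "torus = lebesgue_on {x. \<forall>i. 0 \<le> x $ i \<and> x $ i < 1}"

definition lattice_dot :: "int ^ 'n \<Rightarrow> real ^ 'n \<Rightarrow> real" where
  "lattice_dot k x = (\<Sum>i\<in>UNIV. real_of_int (k $ i) * x $ i)"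

definition char_exp :: "int ^ 'n \<Rightarrow> real ^ 'n \<Rightarrow> complex" where
  "char_exp k x = exp (2 * of_real pi * \<i> * of_real (lattice_dot k x))"

text \<open>The sign convention is \<open>char_exp (- k) x = e^(- 2 pi i k.x)\<close>.\<close>

definition lattice_fourier :: "(int ^ 'n \<Rightarrow> complex) \<Rightarrow> real ^ 'n \<Rightarrow> complex" where
  "lattice_fourier f x = (\<Sum>\<^sub>\<infinity>k. char_exp (- k) x * f k)"

definition symbol_fourier ::
    "(int ^ 'n \<Rightarrow> real ^ 'n \<Rightarrow> complex) \<Rightarrow> int ^ 'n \<Rightarrow> int ^ 'n \<Rightarrow> complex" where
  "symbol_fourier \<sigma> k m = (LINT x|torus. char_exp (- m) x * \<sigma> k x)"

definition Op :: "(int ^ 'n \<Rightarrow> real ^ 'n \<Rightarrow> complex) \<Rightarrow>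
    (int ^ 'n \<Rightarrow> complex) \<Rightarrow> int ^ 'n \<Rightarrow> complex" where
  "Op \<sigma> f k = (LINT x|torus. char_exp k x * \<sigma> k x * lattice_fourier f x)"

definition Op_ell :: "real \<Rightarrow> (int ^ 'n \<Rightarrow> real ^ 'n \<Rightarrow> complex) \<Rightarrow>
    (int ^ 'n \<Rightarrow> complex) \<Rightarrow> int ^ 'n \<Rightarrow> complex" where
  "Op_ell p \<sigma> = density_extension p (Op \<sigma>)"

end

theory Submission
  imports Defs
begin

text \<open>On \<open>ell 1\<close>, integrating the Fourier series of \<open>f\<close> termwise against \<open>\<sigma> k\<close> shows that the
  operator has the matrix \<open>symbol_fourier \<sigma> k (m - k)\<close>, which is dominated by the convolution
  kernel \<open>C * norm (\<omega> (m - k))\<close>. Jensen's inequality for the weights \<open>norm (\<omega> (m - k))\<close>,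
  followed by summation over \<open>k\<close>, bounds this matrix on \<open>ell p\<close> by \<open>C * ell_norm 1 \<omega>\<close>, so it
  is the continuous extension from the dense subspace \<open>ell 1\<close>.\<close>

section \<open>The sequence spaces\<close>

lemma ell_1_iff: "f \<in> ell 1 \<longleftrightarrow> (\<lambda>k. norm (f k)) summable_on UNIV"
  by (simp add: ell_def)

lemma ell_norm_1: "ell_norm 1 f = (\<Sum>\<^sub>\<infinity>k. norm (f k))"
  by (simp add: ell_norm_def infsum_nonneg)

lemma ell_norm_nonneg: "0 \<le> ell_norm p f"
  by (simp add: ell_norm_def)

text \<open>One term of a nonnegative sum is at most the whole sum. This makes elements of
  \<open>ell p\<close> bounded and turns \<open>ell p\<close> convergence into pointwise
  convergence.\<close>

lemma norm_le_ell_norm: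
  assumes "0 < p" "f \<in> ell p"
  shows "norm (f k) \<le> ell_norm p f"
proof -
  have "(\<Sum>j\<in>{k}. norm (f j) powr p) \<le> (\<Sum>\<^sub>\<infinity>j. norm (f j) powr p)"
    using assms by (intro finite_sum_le_infsum) (auto simp: ell_def)
  then have "(norm (f k) powr p) powr (1 / p) \<le> ell_norm p f"
    unfolding ell_norm_def using assms by (intro powr_mono2) auto
  then show ?thesis
    using assms by (simp add: powr_powr)
qed

text \<open>Only membership matters, so the crude estimate by twice the larger modulus takes the
  place of Minkowski's inequality.\<close>

lemma ell_add:
  assumes "0 \<le> p" "f \<in> ell p" "g \<in> ell p"
  shows "(\<lambda>k. f k + g k) \<in> ell p"
proof -
  have "norm (f k + g k) powr p \<le> 2 powr p * (norm (f k) powr p + norm (g k) powr p)" for k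
  proof -
    have "norm (f k + g k) \<le> 2 * max (norm (f k)) (norm (g k))"
      using norm_triangle_ineq[of "f k" "g k"] by linarith
    then have "norm (f k + g k) powr p \<le> (2 * max (norm (f k)) (norm (g k))) powr p"
      using assms by (intro powr_mono2) auto
    also have "\<dots> = 2 powr p * max (norm (f k)) (norm (g k)) powr p"
      by (simp add: powr_mult)
    also have "\<dots> \<le> 2 powr p * (norm (f k) powr p + norm (g k) powr p)"
      by (intro mult_left_mono) (auto simp: max_def)
    finally show ?thesis .
  qed
  moreover have "(\<lambda>k. 2 powr p * (norm (f k) powr p + norm (g k) powr p)) summable_on UNIV"
    using assms by (intro summable_on_cmult_right summable_on_add) (auto simp: ell_def)
  ultimately show ?thesis
    unfolding ell_def by (auto intro: summable_on_comparison_test)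
qed

lemma ell_cmult:
  assumes "f \<in> ell p"
  shows "(\<lambda>k. c * f k) \<in> ell p"
  using assms
  by (auto simp: ell_def norm_mult powr_mult intro: summable_on_cmult_right)

lemma ell_diff:
  assumes "0 \<le> p" "f \<in> ell p" "g \<in> ell p"
  shows "(\<lambda>k. f k - g k) \<in> ell p"
  using ell_add[OF assms(1,2) ell_cmult[OF assms(3), of "-1"]] by simp

text \<open>Since \<open>p - 1 \<ge> 0\<close>, the factor \<open>norm (f k) powr (p - 1)\<close> is
  at most the constant \<open>ell_norm 1 f powr (p - 1)\<close>; what remains is summable.\<close>

lemma ell_1_subset:
  assumes "1 \<le> p"
  shows "ell 1 \<subseteq> ell p"
proof
  fix f :: "'a \<Rightarrow> complex" assume f: "f \<in> ell 1"
  have "norm (f k) powr p \<le> norm (f k) * ell_norm 1 f powr (p - 1)" for k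
  proof -
    have "norm (f k) powr p = norm (f k) * norm (f k) powr (p - 1)"
      by (subst powr_mult_base) auto
    also have "\<dots> \<le> norm (f k) * ell_norm 1 f powr (p - 1)"
      using assms norm_le_ell_norm[OF _ f, of k]
      by (auto intro!: mult_left_mono powr_mono2)
    finally show ?thesis .
  qed
  moreover have "(\<lambda>k. norm (f k) * ell_norm 1 f powr (p - 1)) summable_on UNIV"
    using f by (intro summable_on_cmult_left) (simp add: ell_1_iff)
  ultimately show "f \<in> ell p"
    unfolding ell_def by (auto intro: summable_on_comparison_test)
qed

text \<open>Truncations of \<open>f\<close> to finite sets lie in \<open>ell 1\<close>, and their
  error is a tail of the convergent sum of \<open>norm (f k) powr p\<close>.\<close>

lemma ell_1_dense:
  assumes "1 \<le> p" "f \<in> ell p"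
  shows "\<exists>F. (\<forall>j::nat. F j \<in> ell 1) \<and> (\<lambda>j. ell_norm p (\<lambda>k. F j k - f k)) \<longlonglongrightarrow> 0"
proof -
  let ?f = "\<lambda>k. norm (f k) powr p"
  have f: "?f summable_on UNIV"
    using assms by (simp add: ell_def)
  have "\<exists>X. finite X \<and> dist (sum ?f X) (infsum ?f UNIV) \<le> 1 / real (Suc j)" for j
    using infsum_finite_approximation[OF f, of "1 / real (Suc j)"] by auto
  then obtain X where fin: "\<And>j. finite (X j)"
    and X: "\<And>j. dist (sum ?f (X j)) (infsum ?f UNIV) \<le> 1 / real (Suc j)"
    by metis
  define F where "F j k = (if k \<in> X j then f k else 0)" for j k
  have "F j \<in> ell 1" for j
    unfolding ell_1_iff
    using summable_on_finite[OF fin[of j], of "\<lambda>k. norm (f k)"]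
    by (rule summable_on_cong_neutral[THEN iffD1, rotated -1]) (auto simp: F_def)
  moreover have "(\<lambda>j. ell_norm p (\<lambda>k. F j k - f k)) \<longlonglongrightarrow> 0"
  proof (rule tendsto_sandwich[where f = "\<lambda>_. 0" and h = "\<lambda>j. (1 / real (Suc j)) powr (1 / p)"])
    have "ell_norm p (\<lambda>k. F j k - f k) \<le> (1 / real (Suc j)) powr (1 / p)" for j
    proof -
      have s: "?f summable_on - X j"
        using f by (rule summable_on_subset_banach) simp
      have "infsum ?f UNIV = infsum ?f (X j) + infsum ?f (- X j)"
        using infsum_Un_disjoint[OF summable_on_finite[OF fin[of j]] s] by simp
      moreover have "infsum ?f (- X j) = (\<Sum>\<^sub>\<infinity>k. norm (F j k - f k) powr p)"
        by (rule infsum_cong_neutral) (auto simp: F_def)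
      ultimately have "(\<Sum>\<^sub>\<infinity>k. norm (F j k - f k) powr p) \<le> 1 / real (Suc j)"
        using X[of j] fin[of j] by (auto simp: dist_real_def)
      then show ?thesis
        unfolding ell_norm_def using assms by (intro powr_mono2 infsum_nonneg) auto
    qed
    then show "\<forall>\<^sub>F j in sequentially. ell_norm p (\<lambda>k. F j k - f k) \<le> (1 / real (Suc j)) powr (1 / p)"
      by simp
    show "(\<lambda>j. (1 / real (Suc j)) powr (1 / p)) \<longlonglongrightarrow> 0"
      using assms LIMSEQ_inverse_real_of_nat
      by (intro tendsto_zero_powrI) (auto simp: inverse_eq_divide)
  qed (auto simp: ell_norm_nonneg)
  ultimately show ?thesis by blast
qed

text \<open>The bound on \<open>T\<close> makes \<open>A (F j)\<close> converge to
  \<open>T f\<close> along every admissible sequence. Any other candidate limit agrees with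
  \<open>T f\<close> in each coordinate, because \<open>ell p\<close> limits are pointwise
  limits.\<close>

lemma density_extension_eqI:
  assumes p: "1 \<le> p" and B: "0 \<le> B"
    and bound: "\<And>h. h \<in> ell p \<Longrightarrow> T h \<in> ell p \<and> ell_norm p (T h) \<le> B * ell_norm p h"
    and diff: "\<And>g h k. g \<in> ell p \<Longrightarrow> h \<in> ell p \<Longrightarrow> T (\<lambda>k. g k - h k) k = T g k - T h k"
    and A: "\<And>h. h \<in> ell 1 \<Longrightarrow> A h = T h"
    and f: "f \<in> ell p"
  shows "density_extension p A f = T f"
proof -
  have conv: "(\<forall>j. A (F j) \<in> ell p) \<and> (\<lambda>j. ell_norm p (\<lambda>k. A (F j) k - T f k)) \<longlonglongrightarrow> 0"
    if "\<And>j::nat. F j \<in> ell 1" and lim: "(\<lambda>j. ell_norm p (\<lambda>k. F j k - f k)) \<longlonglongrightarrow> 0" for F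
  proof -
    have Fp: "F j \<in> ell p" for j using that(1) ell_1_subset[OF p] by blast
    have AF: "A (F j) = T (F j)" for j using A that(1) by blast
    have "(\<lambda>k. A (F j) k - T f k) = T (\<lambda>k. F j k - f k)" for j
      using diff[OF Fp f] by (simp add: AF fun_eq_iff)
    then have le: "ell_norm p (\<lambda>k. A (F j) k - T f k) \<le> B * ell_norm p (\<lambda>k. F j k - f k)" for j
      using bound[OF ell_diff[OF _ Fp f]] p by simp
    have "(\<lambda>j. B * ell_norm p (\<lambda>k. F j k - f k)) \<longlonglongrightarrow> 0"
      using lim by (rule tendsto_mult_right_zero)
    then have "(\<lambda>j. ell_norm p (\<lambda>k. A (F j) k - T f k)) \<longlonglongrightarrow> 0"
      by (rule tendsto_sandwich[OF _ _ tendsto_const, rotated 2])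
        (use le in \<open>auto simp: ell_norm_nonneg\<close>)
    then show ?thesis using bound[OF Fp] by (simp add: AF)
  qed
  \<comment> \<open>Uniqueness rests on one concrete approximating sequence: without any, the limit
    condition would be vacuous and could not single out \<open>T f\<close>.\<close>
  obtain F :: "nat \<Rightarrow> 'a \<Rightarrow> complex" where F: "\<And>j. F j \<in> ell 1"
    and lim: "(\<lambda>j. ell_norm p (\<lambda>k. F j k - f k)) \<longlonglongrightarrow> 0"
    using ell_1_dense[OF p f] by blast
  have pointwise: "(\<lambda>j. A (F j) k) \<longlonglongrightarrow> u k"
    if "u \<in> ell p" "(\<lambda>j. ell_norm p (\<lambda>k. A (F j) k - u k)) \<longlonglongrightarrow> 0" for u k
  proof -
    have "norm (A (F j) k - u k) \<le> ell_norm p (\<lambda>k. A (F j) k - u k)" for j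
      using norm_le_ell_norm[OF _ ell_diff[OF _ _ that(1)], of "A (F j)" k] conv[OF F lim] p
      by simp
    then have "(\<lambda>j. A (F j) k - u k) \<longlonglongrightarrow> 0"
      by (intro Lim_null_comparison[OF _ that(2)]) simp
    then show ?thesis by (simp add: LIM_zero_iff)
  qed
  have "g = T f" if "g \<in> ell p"
    and "\<forall>F. (\<forall>j::nat. F j \<in> ell 1) \<and> (\<lambda>j. ell_norm p (\<lambda>k. F j k - f k)) \<longlonglongrightarrow> 0 \<longrightarrow>
      (\<forall>j. A (F j) \<in> ell p) \<and> (\<lambda>j. ell_norm p (\<lambda>k. A (F j) k - g k)) \<longlonglongrightarrow> 0" for g
  proof
    fix k
    have "(\<lambda>j. A (F j) k) \<longlonglongrightarrow> g k"
      using pointwise that F lim by blast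
    moreover have "(\<lambda>j. A (F j) k) \<longlonglongrightarrow> T f k"
      using pointwise conv[OF F lim] bound[OF f] by blast
    ultimately show "g k = T f k" by (rule LIMSEQ_unique)
  qed
  then show ?thesis
    unfolding density_extension_def using conv bound[OF f] by (intro the_equality) blast+
qed

section \<open>Kernels dominated by a convolution\<close>

text \<open>The convex function \<open>t powr p\<close> lies above its tangent at \<open>s\<close>.
  This is Young's inequality for \<open>t powr p\<close> and \<open>s powr p\<close> with weights
  \<open>1 / p\<close> and \<open>1 - 1 / p\<close>, rearranged.\<close>

lemma powr_ge_tangent:
  fixes p s t :: real
  assumes "1 \<le> p" "0 < s" "0 \<le> t"
  shows "s powr p + p * s powr (p - 1) * (t - s) \<le> t powr p"
\<comment> \<open>Young's inequality is applied to positive arguments, so \<open>t = 0\<close> is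
  treated apart; there the claim reduces to \<open>(1 - p) * s powr p \<le> 0\<close>.\<close>
proof (cases "t = 0")
  case True
  have "s powr (p - 1) * s = s powr p"
    using assms by (simp add: powr_diff)
  then have "s powr p + p * s powr (p - 1) * (t - s) = (1 - p) * s powr p"
    using True by (simp add: algebra_simps)
  then show ?thesis using True assms by (simp add: mult_nonpos_nonneg)
next
  case False
  have "(t powr p) powr (1 / p) * (s powr p) powr (1 - 1 / p) \<le> 1 / p * t powr p + (1 - 1 / p) * s powr p"
    using assms False by (intro Youngs_inequality_0) auto
  then have "t * s powr (p - 1) \<le> 1 / p * t powr p + (1 - 1 / p) * s powr p"
    using assms by (simp add: powr_powr right_diff_distrib)
  then have "p * (t * s powr (p - 1)) \<le> p * (1 / p * t powr p + (1 - 1 / p) * s powr p)"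
    using assms by (intro mult_left_mono) auto
  also have "\<dots> = t powr p + (p - 1) * s powr p"
    using assms by (simp add: field_simps)
  finally have "p * (t * s powr (p - 1)) \<le> t powr p + (p - 1) * s powr p" .
  moreover have "p * s powr (p - 1) * (t - s) = p * (t * s powr (p - 1)) - p * s powr p"
    using powr_mult_base[of s "p - 1"] assms by (simp add: algebra_simps flip: distrib_left)
  ultimately show ?thesis by (simp add: left_diff_distrib)
qed

text \<open>Jensen's inequality for weights of arbitrary total mass. Keeping a power of the mass on
  the right avoids normalising the weights and covers mass zero.\<close>

lemma infsum_powr_le:
  fixes w t :: "'a \<Rightarrow> real"
  assumes p: "1 \<le> p" and w: "\<And>m. 0 \<le> w m" and t: "\<And>m. 0 \<le> t m"
    and sw: "w summable_on UNIV" and swt: "(\<lambda>m. w m * t m) summable_on UNIV"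
    and swp: "(\<lambda>m. w m * t m powr p) summable_on UNIV"
  shows "(\<Sum>\<^sub>\<infinity>m. w m * t m) powr p \<le> infsum w UNIV powr (p - 1) * (\<Sum>\<^sub>\<infinity>m. w m * t m powr p)"
proof -
  define W where "W = infsum w UNIV"
  define I where "I = (\<Sum>\<^sub>\<infinity>m. w m * t m)"
  define s where "s = I / W"
  have "0 \<le> W" unfolding W_def using w by (intro infsum_nonneg) auto
  have "0 \<le> I" unfolding I_def using w t by (intro infsum_nonneg) auto
  have P0: "0 \<le> (\<Sum>\<^sub>\<infinity>m. w m * t m powr p)" using w t by (intro infsum_nonneg) auto
  show ?thesis
  proof (cases "I = 0")
    case True
    then show ?thesis using P0 unfolding I_def by simp
  next
    case False
    \<comment> \<open>Total mass zero would make every weight vanish and hence force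
      \<open>I = 0\<close>.\<close>
    have "W \<noteq> 0"
    proof
      assume "W = 0"
      then have "w m = 0" for m
        using nonneg_infsum_le_0D[of w UNIV m] sw w unfolding W_def by auto
      then show False using False unfolding I_def by simp
    qed
    with False \<open>0 \<le> W\<close> \<open>0 \<le> I\<close> have pos: "0 < W" "0 < I" "0 < s" by (auto simp: s_def)
    \<comment> \<open>Average the tangent line of \<open>t powr p\<close> at the weighted mean \<open>s\<close>.\<close>
    let ?c = "s powr p - p * s powr (p - 1) * s" and ?d = "p * s powr (p - 1)"
    have sl: "(\<lambda>m. ?c * w m + ?d * (w m * t m)) summable_on UNIV"
      using sw swt by (intro summable_on_add summable_on_cmult_right)
    have "(\<Sum>\<^sub>\<infinity>m. ?c * w m + ?d * (w m * t m)) \<le> (\<Sum>\<^sub>\<infinity>m. w m * t m powr p)"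
    proof (rule infsum_mono[OF sl swp])
      fix m
      have "w m * (s powr p + p * s powr (p - 1) * (t m - s)) \<le> w m * t m powr p"
        using w by (intro mult_left_mono powr_ge_tangent[OF p pos(3) t])
      then show "?c * w m + ?d * (w m * t m) \<le> w m * t m powr p"
        by (simp add: algebra_simps)
    qed
    also have "(\<Sum>\<^sub>\<infinity>m. ?c * w m + ?d * (w m * t m)) = ?c * W + ?d * I"
      using sw swt unfolding W_def I_def
      by (subst infsum_add) (auto intro: summable_on_cmult_right simp: infsum_cmult_right')
    \<comment> \<open>At the weighted mean \<open>s * W = I\<close>, so the two terms with the
      factor \<open>p\<close> cancel.\<close>
    also have "\<dots> = W * s powr p"
      using pos by (simp add: s_def algebra_simps)
    finally have *: "W * s powr p \<le> (\<Sum>\<^sub>\<infinity>m. w m * t m powr p)" .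
    have "I powr p = W powr p * s powr p"
      using pos by (simp add: s_def flip: powr_mult)
    also have "\<dots> = W powr (p - 1) * (W * s powr p)"
      using pos by (simp add: powr_diff)
    also have "\<dots> \<le> W powr (p - 1) * (\<Sum>\<^sub>\<infinity>m. w m * t m powr p)"
      using * by (intro mult_left_mono) auto
    finally show ?thesis unfolding I_def W_def .
  qed
qed

context
  fixes K :: "'a::ab_group_add \<Rightarrow> 'a \<Rightarrow> complex" and w :: "'a \<Rightarrow> complex" and C :: real
  assumes C: "0 \<le> C" and w: "w \<in> ell 1"
    and K: "\<And>k m. norm (K k m) \<le> C * norm (w (m - k))"
begin

text \<open>Row sums of the kernel run over translates of \<open>w\<close>, column sums over
  reflected translates. Both are reindexings by bijections of the group. Rows supply the total mass
  for Jensen, columns the sum over \<open>k\<close> after the interchange.\<close>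

lemma shift_summable: "(\<lambda>m. norm (w (m - k))) summable_on UNIV"
  and shift_infsum: "(\<Sum>\<^sub>\<infinity>m. norm (w (m - k))) = ell_norm 1 w"
  and reflect_summable: "(\<lambda>m. norm (w (k - m))) summable_on UNIV"
  and reflect_infsum: "(\<Sum>\<^sub>\<infinity>m. norm (w (k - m))) = ell_norm 1 w"
proof -
  have 1: "bij (\<lambda>m. m - k)" by (rule bij_betw_byWitness[where f' = "\<lambda>m. m + k"]) auto
  have 2: "bij (\<lambda>m. k - m)" by (rule bij_betw_byWitness[where f' = "\<lambda>m. k - m"]) auto
  show "(\<lambda>m. norm (w (m - k))) summable_on UNIV" "(\<lambda>m. norm (w (k - m))) summable_on UNIV"
    using w summable_on_reindex_bij_betw[OF 1, of "\<lambda>m. norm (w m)"]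
      summable_on_reindex_bij_betw[OF 2, of "\<lambda>m. norm (w m)"] by (auto simp: ell_1_iff)
  show "(\<Sum>\<^sub>\<infinity>m. norm (w (m - k))) = ell_norm 1 w" "(\<Sum>\<^sub>\<infinity>m. norm (w (k - m))) = ell_norm 1 w"
    using infsum_reindex_bij_betw[OF 1, of "\<lambda>m. norm (w m)"]
      infsum_reindex_bij_betw[OF 2, of "\<lambda>m. norm (w m)"] by (auto simp: ell_norm_1)
qed

text \<open>The values of \<open>f\<close> are bounded by \<open>ell_norm p f\<close>, so
  summability of \<open>w\<close> suffices.\<close>

lemma convolution_summable:
  assumes "0 < p" "f \<in> ell p"
  shows "(\<lambda>m. norm (w (m - k)) * norm (f m)) summable_on UNIV"
proof (rule summable_on_comparison_test)
  show "(\<lambda>m. norm (w (m - k)) * ell_norm p f) summable_on UNIV"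
    by (intro summable_on_cmult_left shift_summable)
qed (use norm_le_ell_norm[OF assms] in \<open>auto intro: mult_left_mono\<close>)

lemma kernel_abs_summable:
  assumes "0 < p" "f \<in> ell p"
  shows "(\<lambda>m. norm (K k m * f m)) summable_on UNIV"
proof (rule summable_on_comparison_test)
  show "(\<lambda>m. C * (norm (w (m - k)) * norm (f m))) summable_on UNIV"
    by (intro summable_on_cmult_right convolution_summable[OF assms])
  show "norm (K k m * f m) \<le> C * (norm (w (m - k)) * norm (f m))" for m
    using mult_right_mono[OF K[of k m], of "norm (f m)"] by (simp add: norm_mult mult.assoc)
qed auto

lemmas kernel_summable = abs_summable_summable[OF kernel_abs_summable]

text \<open>Jensen in each row costs \<open>W powr (p - 1)\<close>, and the column sums contribute
  one more factor \<open>W\<close>. With \<open>C powr p\<close> this is the \<open>p\<close>-th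
  power of \<open>C * W\<close>.\<close>

lemma kernel_bound:
  assumes p: "1 \<le> p" and f: "f \<in> ell p"
  defines "g \<equiv> \<lambda>k. \<Sum>\<^sub>\<infinity>m. K k m * f m"
  shows "g \<in> ell p \<and> ell_norm p g \<le> C * ell_norm 1 w * ell_norm p f"
proof -
  define W where "W = ell_norm 1 w"
  define N where "N = (\<Sum>\<^sub>\<infinity>m. norm (f m) powr p)"
  have W: "0 \<le> W" by (simp add: W_def ell_norm_nonneg)
  have N: "0 \<le> N" unfolding N_def by (intro infsum_nonneg) auto
  have sf: "(\<lambda>m. norm (f m) powr p) summable_on UNIV"
    using f by (simp add: ell_def)
  let ?h = "\<lambda>k m. norm (w (m - k)) * norm (f m) powr p"
  \<comment> \<open>Double summability is checked with \<open>m\<close> outermost, where the inner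
    sum is explicitly \<open>W * norm (f m) powr p\<close>, and then transferred to the other
    order.\<close>
  have "(\<lambda>(m, k). ?h k m) summable_on UNIV \<times> UNIV"
  proof (rule summable_on_SigmaI)
    show "((\<lambda>k. case (m, k) of (m, k) \<Rightarrow> ?h k m) has_sum W * norm (f m) powr p) UNIV" for m
      using has_sum_cmult_left[OF has_sum_infsum[OF reflect_summable]]
      by (simp add: reflect_infsum W_def)
  qed (use sf in \<open>auto intro: summable_on_cmult_right\<close>)
  then have sh: "(\<lambda>(k, m). ?h k m) summable_on UNIV \<times> UNIV"
    by (subst summable_on_swap) simp
  have "(\<Sum>\<^sub>\<infinity>k. \<Sum>\<^sub>\<infinity>m. ?h k m) = (\<Sum>\<^sub>\<infinity>m. \<Sum>\<^sub>\<infinity>k. ?h k m)"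
    by (rule infsum_swap_banach[OF sh])
  also have "\<dots> = W * N"
    by (simp add: infsum_cmult_left' infsum_cmult_right' reflect_infsum W_def N_def)
  finally have total: "(\<Sum>\<^sub>\<infinity>k. \<Sum>\<^sub>\<infinity>m. ?h k m) = W * N" .
  have s1: "(\<lambda>k. \<Sum>\<^sub>\<infinity>m. ?h k m) summable_on UNIV"
    using summable_on_Sigma_banach[OF sh] .
  have s2: "?h k summable_on UNIV" for k
    using summable_on_SigmaD1[OF sh] by simp
  have le: "norm (g k) powr p \<le> C powr p * W powr (p - 1) * (\<Sum>\<^sub>\<infinity>m. ?h k m)" for k
  proof -
    have sc: "(\<lambda>m. norm (w (m - k)) * norm (f m)) summable_on UNIV"
      using p f by (intro convolution_summable) auto
    have "norm (g k) \<le> (\<Sum>\<^sub>\<infinity>m. norm (K k m * f m))"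
      unfolding g_def using p f by (intro norm_infsum_bound kernel_abs_summable) auto
    also have "\<dots> \<le> (\<Sum>\<^sub>\<infinity>m. C * (norm (w (m - k)) * norm (f m)))"
    proof (rule infsum_mono)
      show "norm (K k m * f m) \<le> C * (norm (w (m - k)) * norm (f m))" for m
        using mult_right_mono[OF K[of k m], of "norm (f m)"] by (simp add: norm_mult mult.assoc)
    qed (use p f sc kernel_abs_summable[of p f] in \<open>auto intro: summable_on_cmult_right\<close>)
    also have "\<dots> = C * (\<Sum>\<^sub>\<infinity>m. norm (w (m - k)) * norm (f m))"
      by (rule infsum_cmult_right')
    finally have "norm (g k) powr p \<le> (C * (\<Sum>\<^sub>\<infinity>m. norm (w (m - k)) * norm (f m))) powr p"
      using p by (intro powr_mono2) auto
    also have "\<dots> = C powr p * (\<Sum>\<^sub>\<infinity>m. norm (w (m - k)) * norm (f m)) powr p"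
      using C by (simp add: powr_mult infsum_nonneg)
    also have "\<dots> \<le> C powr p * (W powr (p - 1) * (\<Sum>\<^sub>\<infinity>m. ?h k m))"
      using infsum_powr_le[OF p _ _ shift_summable sc s2]
      by (intro mult_left_mono) (auto simp: shift_infsum W_def)
    finally show ?thesis by (simp add: mult.assoc)
  qed
  have s3: "(\<lambda>k. C powr p * W powr (p - 1) * (\<Sum>\<^sub>\<infinity>m. ?h k m)) summable_on UNIV"
    by (intro summable_on_cmult_right s1)
  have s4: "(\<lambda>k. norm (g k) powr p) summable_on UNIV"
    by (rule summable_on_comparison_test[OF s3]) (use le in auto)
  have "(\<Sum>\<^sub>\<infinity>k. norm (g k) powr p) \<le> (\<Sum>\<^sub>\<infinity>k. C powr p * W powr (p - 1) * (\<Sum>\<^sub>\<infinity>m. ?h k m))"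
    by (rule infsum_mono[OF s4 s3 le])
  also have "\<dots> = C powr p * W powr (p - 1) * (W * N)"
    by (simp add: infsum_cmult_right' total)
  \<comment> \<open>Writing \<open>W powr (p - 1)\<close> as a quotient by \<open>W\<close> requires
    \<open>W \<noteq> 0\<close> to cancel; for \<open>W = 0\<close> both sides vanish.\<close>
  also have "\<dots> = (C * W) powr p * N"
    using C W by (cases "W = 0") (simp_all add: powr_mult powr_diff)
  finally have "ell_norm p g \<le> ((C * W) powr p * N) powr (1 / p)"
    unfolding ell_norm_def using p by (intro powr_mono2 infsum_nonneg) auto
  also have "\<dots> = C * W * ell_norm p f"
    using p C W N by (simp add: powr_mult powr_powr ell_norm_def N_def)
  finally show ?thesis
    using s4 by (simp add: ell_def W_def)
qed

end

section \<open>The operator as an infinite matrix\<close>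

lemma norm_char_exp: "norm (char_exp k x) = 1"
proof -
  have "char_exp k x = exp (\<i> * of_real (2 * pi * lattice_dot k x))"
    by (simp add: char_exp_def mult_ac)
  then show ?thesis by (simp only: norm_exp_i_times)
qed

lemma char_exp_mult: "char_exp k x * char_exp m x = char_exp (k + m) x"
proof -
  have "lattice_dot (k + m) x = lattice_dot k x + lattice_dot m x"
    by (simp add: lattice_dot_def sum.distrib distrib_right)
  then show ?thesis
    by (simp add: char_exp_def distrib_left exp_add)
qed

lemma char_exp_measurable: "char_exp k \<in> borel_measurable torus"
proof -
  have "continuous_on UNIV (char_exp k)"
    unfolding char_exp_def[abs_def] lattice_dot_def by (intro continuous_intros)
  then have "char_exp k \<in> borel_measurable lborel"
    by (simp add: borel_measurable_continuous_onI)
  then have "char_exp k \<in> borel_measurable lebesgue"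
    by (rule measurable_completion)
  then show ?thesis
    unfolding torus_def by (rule measurable_restrict_space1)
qed

lemma integrable_char_exp_mult:
  assumes "integrable torus g"
  shows "integrable torus (\<lambda>x. char_exp k x * g x)"
  using assms char_exp_measurable[of k]
  by (intro Bochner_Integration.integrable_bound[OF assms])
    (auto simp: norm_mult norm_char_exp intro: borel_measurable_times)

text \<open>Enumerating the lattice lets termwise integration of ordinary series be applied to sums
  over \<open>int ^ 'n\<close>. Constant vectors show that the lattice is infinite.\<close>

lemma bij_nat_lattice: "\<exists>e. bij (e :: nat \<Rightarrow> int ^ 'n)"
proof -
  have "inj (vec :: int \<Rightarrow> int ^ 'n)"
    by (auto simp: inj_def vec_eq_iff)
  then have "infinite (UNIV :: (int ^ 'n) set)"
    using infinite_UNIV_int finite_imageD[of vec] finite_subset[OF subset_UNIV] by metis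
  moreover have "countable (UNIV :: (int ^ 'n) set)"
    by simp
  ultimately show ?thesis using bij_betw_from_nat_into by blast
qed

text \<open>The characters at \<open>k\<close> and \<open>- m\<close> multiply to the one at
  \<open>- (m - k)\<close>, so the \<open>m\<close>-th term of the Fourier series integrates to a
  Fourier coefficient of \<open>\<sigma> k\<close> at \<open>m - k\<close>.\<close>

lemma Op_eq_infsum:
  fixes \<sigma> :: "int ^ 'n \<Rightarrow> real ^ 'n \<Rightarrow> complex"
  assumes \<sigma>: "integrable torus (\<sigma> k)" and f: "f \<in> ell 1"
    and sum: "(\<lambda>m. symbol_fourier \<sigma> k (m - k) * f m) summable_on UNIV"
  shows "Op \<sigma> f k = (\<Sum>\<^sub>\<infinity>m. symbol_fourier \<sigma> k (m - k) * f m)"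
proof -
  obtain e :: "nat \<Rightarrow> int ^ 'n" where e: "bij e" using bij_nat_lattice by blast
  let ?G = "\<lambda>i x. char_exp (- (e i - k)) x * \<sigma> k x * f (e i)"
  have "(\<lambda>m. norm (f m)) summable_on UNIV" using f by (simp add: ell_1_iff)
  then have "(\<lambda>i. norm (f (e i))) summable_on UNIV"
    by (subst summable_on_reindex_bij_betw[OF e])
  then have fe: "summable (\<lambda>i. norm (f (e i)))"
    using has_sum_imp_sums sums_summable by (auto simp: summable_on_def)
  have G: "integrable torus (?G i)" for i
    using integrable_char_exp_mult[OF \<sigma>] by (intro integrable_mult_left) simp
  \<comment> \<open>Characters have modulus 1, so the norm factors into an integrable function of
    \<open>x\<close> and a summable function of \<open>i\<close>, which justifies termwise
    integration.\<close>
  have nG: "norm (?G i x) = norm (\<sigma> k x) * norm (f (e i))" for i x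
    by (simp add: norm_mult norm_char_exp)
  have "(\<lambda>i. integral\<^sup>L torus (?G i)) sums (LINT x|torus. (\<Sum>i. ?G i x))"
  proof (rule sums_integral[OF G])
    show "AE x in torus. summable (\<lambda>i. norm (?G i x))"
      unfolding nG by (intro AE_I2 summable_mult fe)
    show "summable (\<lambda>i. LINT x|torus. norm (?G i x))"
      unfolding nG by (simp add: summable_mult fe)
  qed
  moreover have "(\<Sum>i. ?G i x) = char_exp k x * \<sigma> k x * lattice_fourier f x" for x
  proof -
    have "(\<lambda>m. char_exp (- m) x * f m) summable_on UNIV"
      by (rule abs_summable_summable) (use f in \<open>simp add: norm_mult norm_char_exp ell_1_iff\<close>)
    then have "((\<lambda>m. char_exp (- m) x * f m) has_sum lattice_fourier f x) UNIV"
      unfolding lattice_fourier_def by (rule has_sum_infsum)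
    then have "((\<lambda>i. char_exp (- e i) x * f (e i)) has_sum lattice_fourier f x) UNIV"
      by (subst has_sum_reindex_bij_betw[OF e, of "\<lambda>m. char_exp (- m) x * f m"])
    then have "(\<lambda>i. char_exp (- e i) x * f (e i)) sums lattice_fourier f x"
      by (rule has_sum_imp_sums)
    then have "(\<lambda>i. char_exp k x * \<sigma> k x * (char_exp (- e i) x * f (e i)))
        sums (char_exp k x * \<sigma> k x * lattice_fourier f x)"
      by (rule sums_mult)
    moreover have "char_exp k x * \<sigma> k x * (char_exp (- e i) x * f (e i)) = ?G i x" for i
      using char_exp_mult[of k x "- e i"] by (simp add: mult_ac)
    ultimately show ?thesis by (simp add: sums_iff)
  qed
  moreover have "integral\<^sup>L torus (?G i) = symbol_fourier \<sigma> k (e i - k) * f (e i)" for i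
    by (simp add: symbol_fourier_def)
  ultimately have "(\<lambda>i. symbol_fourier \<sigma> k (e i - k) * f (e i)) sums Op \<sigma> f k"
    by (simp only: Op_def)
  \<comment> \<open>By \<open>sum\<close>, the unordered sum is a genuine limit rather than the
    default value 0, so it equals the series along \<open>e\<close>.\<close>
  moreover have "((\<lambda>i. symbol_fourier \<sigma> k (e i - k) * f (e i)) has_sum
      (\<Sum>\<^sub>\<infinity>m. symbol_fourier \<sigma> k (m - k) * f m)) UNIV"
    by (subst has_sum_reindex_bij_betw[OF e, of "\<lambda>m. symbol_fourier \<sigma> k (m - k) * f m"])
      (rule has_sum_infsum[OF sum])
  ultimately show ?thesis by (blast intro: sums_unique2 has_sum_imp_sums)
qed

text \<open>The middle conjunct ties the extension to the integral formula on \<open>ell 1\<close>;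
  a definite description alone would not guarantee this.\<close>

theorem proposition5p12:
  fixes p C :: real
    and \<sigma> :: "int ^ 'n \<Rightarrow> real ^ 'n \<Rightarrow> complex"
    and \<omega> :: "int ^ 'n \<Rightarrow> complex"
  assumes "1 \<le> p"
    and "\<And>k. torus_periodic (\<sigma> k)"
    and "(\<lambda>(k, x). \<sigma> k x) \<in> borel_measurable (count_space UNIV \<Otimes>\<^sub>M torus)"
    and "\<And>k. integrable torus (\<sigma> k)"
    and "C > 0"
    and "\<omega> \<in> ell 1"
    and "\<And>k m. norm (symbol_fourier \<sigma> k m) \<le> C * norm (\<omega> m)"
  shows "bounded_linear_ell p (Op_ell p \<sigma>) \<and>
    (\<forall>f\<in>ell 1. Op_ell p \<sigma> f = Op \<sigma> f) \<and>
    onorm_ell p (Op_ell p \<sigma>) \<le> C * ell_norm 1 \<omega>"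
proof -
  define K where "K k m = symbol_fourier \<sigma> k (m - k)" for k m
  \<comment> \<open>The matrix sum makes sense on all of \<open>ell p\<close>, where the integral
    formula may not, and is the candidate for the extension.\<close>
  define T where "T f k = (\<Sum>\<^sub>\<infinity>m. K k m * f m)" for f k
  let ?B = "C * ell_norm 1 \<omega>"
  have p: "0 < p" "0 \<le> p" and C: "0 \<le> C" and B: "0 \<le> ?B"
    using assms by (auto simp: ell_norm_nonneg)
  have K: "norm (K k m) \<le> C * norm (\<omega> (m - k))" for k m
    unfolding K_def by (rule assms)
  note summable = kernel_summable[where K = K, OF C assms(6) K]
  have bound: "T f \<in> ell p \<and> ell_norm p (T f) \<le> ?B * ell_norm p f" if "f \<in> ell p" for f
    using kernel_bound[where K = K, OF C assms(6) K assms(1) that]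
    unfolding T_def[abs_def] by blast
  have add: "T (\<lambda>k. f k + g k) k = T f k + T g k" if "f \<in> ell p" "g \<in> ell p" for f g k
    unfolding T_def distrib_left using that summable[OF p(1)] by (intro infsum_add) auto
  have scale: "T (\<lambda>k. c * f k) k = c * T f k" for f c k
    unfolding T_def by (simp add: mult.left_commute[of _ c] infsum_cmult_right')
  have diff: "T (\<lambda>k. f k - g k) k = T f k - T g k" if "f \<in> ell p" "g \<in> ell p" for f g k
    using add[OF that(1) ell_cmult[OF that(2), of "-1"], of k] scale[of "-1" g k] by simp
  have Op: "Op \<sigma> f = T f" if "f \<in> ell 1" for f
    using Op_eq_infsum[of \<sigma> _ f] assms(4) that summable[OF zero_less_one that]
    by (fastforce simp: T_def K_def)
  have ext: "Op_ell p \<sigma> f = T f" if "f \<in> ell p" for f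
    unfolding Op_ell_def
    by (rule density_extension_eqI[OF assms(1) B bound diff Op that])
  have "bounded_linear_ell p (Op_ell p \<sigma>)"
    unfolding bounded_linear_ell_def
  proof (intro conjI ballI allI exI)
    show "Op_ell p \<sigma> f \<in> ell p" "ell_norm p (Op_ell p \<sigma> f) \<le> ?B * ell_norm p f"
      if "f \<in> ell p" for f
      using ext bound that by auto
    show "Op_ell p \<sigma> (\<lambda>k. f k + g k) = (\<lambda>k. Op_ell p \<sigma> f k + Op_ell p \<sigma> g k)"
      if "f \<in> ell p" "g \<in> ell p" for f g
      using add[OF that] by (simp add: ext that ell_add[OF p(2)] fun_eq_iff)
    show "Op_ell p \<sigma> (\<lambda>k. c * f k) = (\<lambda>k. c * Op_ell p \<sigma> f k)" if "f \<in> ell p" for f c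
      using scale by (simp add: ext that ell_cmult fun_eq_iff)
  qed
  moreover have "Op_ell p \<sigma> f = Op \<sigma> f" if "f \<in> ell 1" for f
    using ext Op that ell_1_subset[OF assms(1)] by fastforce
  moreover have "onorm_ell p (Op_ell p \<sigma>) \<le> ?B"
    unfolding onorm_ell_def
  proof (rule cSUP_least)
    \<comment> \<open>The supremum bound requires a nonempty index set; \<open>\<omega>\<close>
      itself is a member.\<close>
    show "(ell p :: (int ^ 'n \<Rightarrow> complex) set) \<noteq> {}"
      using assms(6) ell_1_subset[OF assms(1)] by blast
    fix f :: "int ^ 'n \<Rightarrow> complex" assume f: "f \<in> ell p"
    \<comment> \<open>For \<open>ell_norm p f = 0\<close> the quotient is 0 by convention, and
      \<open>0 \<le> ?B\<close> suffices.\<close>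
    show "ell_norm p (Op_ell p \<sigma> f) / ell_norm p f \<le> ?B"
      using bound[OF f] ext[OF f] B ell_norm_nonneg[of p f]
      by (cases "ell_norm p f = 0") (auto simp: divide_le_eq)
  qed
  ultimately show ?thesis by blast
qed

end
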